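(* The omega one of the class of open games of Infinite Hex is the smallest infinite ordinal, that is, $\omega_1^{\rm Hex}=\omega$.
   Context: Infinite Hex board: cells are pairs $(a,j)$ with $j\in\mathbb{Z}$, $a\in\mathbb{Z}+j/2$; $(a,j),(a',j')$ adjacent iff ($j=j'$, $|a-a'|=1$) or ($|j-j'|=1$, $|a-a'|=1/2$). A configuration marks each cell empty, Red or Blue. A Red (Blue) $\mathbb{Z}$-chain is $r:\mathbb{Z}\to$ cells with all $r(n)$ Red (Blue) and $r(n),r(n+1)$ adjacent. A Red chain is winning w.r.t. $h_0=(a_0,j_0)$ if for some $M$ and all $m\ge M$, $r(m)=(a,j)$ satisfies $a>a_0,j>j_0$ and $r(-m)=(a,j)$ satisfies $a<a_0,j<j_0$; a Blue chain $b$ is winning w.r.t. $h_0$ if eventually $b(m)$ satisfies $a<a_0,j>j_0$ and $b(-m)$ satisfies $a>a_0,j<j_0$. A chain is winning if winning w.r.t. every cell. A game of Infinite Hex is given by an initial configuration (possibly with infinitely many marked cells) and a player to move; players alternately mark an empty cell in their colour; a player wins as soon as his cells contain a winning chain of his colour. A game is open for a player if every play won by that player is decided after finitely many moves (the player's set of winning plays is open in the topology on plays with basic open sets $U(v)$ = plays through position $v$). Game value for the open player $O$ (opponent $C$): a position where $O$ has already won has value $0$; if $O$ is to move and $\alpha$ is least among values of successors having values, the value is $\alpha+1$; if $C$ is to move and all successors have values, the value is their supremum; otherwise undefined. The omega one of the class of open games of Infinite Hex is the supremum of the game values, for the designated open player, of all games of Infinite Hex open for that player which have a value. *)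

theory Defs
  imports "HOL-Analysis.Abstract_Topology" "HOL-Library.Countable_Set"
begin

unbundle cardinal_syntax

section \<open>Ordinals\<close>

text \<open>
  HOL has no type of all ordinals. The type below consists of the order types of all well-orders
  on sets of sets of naturals, i.e. of all ordinals below \<open>\<kappa>\<^sup>+\<close>, where \<open>\<kappa>\<close> is the cardinality
  of the continuum. Every family of at most continuum many such ordinals is bounded
  (lemma \<open>ordinal_bounded\<close>), and there are only continuum many configurations of the board,
  so no game value and no supremum of game values is lost.
\<close>

quotient_type ordinal = "nat set rel" / partial: "\<lambda>r s. r =o s"
proof (rule part_equivpI)
  show "\<exists>r::nat set rel. r =o r"
    using card_of_refl by blast
  show "symp (\<lambda>r s::nat set rel. r =o s)"
    by (rule sympI) (rule ordIso_symmetric)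
  show "transp (\<lambda>r s::nat set rel. r =o s)"
    by (rule transpI) (rule ordIso_transitive)
qed

lemma ordIso_Well_orderD: "r =o s \<Longrightarrow> Well_order r" "r =o s \<Longrightarrow> Well_order s"
  unfolding ordIso_def by auto

instantiation ordinal :: wellorder
begin

lift_definition less_eq_ordinal :: "ordinal \<Rightarrow> ordinal \<Rightarrow> bool" is "\<lambda>r s. r \<le>o s"
  by (meson ordIso_ordLeq_trans ordIso_symmetric ordLeq_ordIso_trans)

lift_definition less_ordinal :: "ordinal \<Rightarrow> ordinal \<Rightarrow> bool" is "\<lambda>r s. r <o s"
  by (meson ordIso_ordLess_trans ordIso_symmetric ordLess_ordIso_trans)

instance
proof
  fix x y z :: ordinal
  show "x < y \<longleftrightarrow> x \<le> y \<and> \<not> y \<le> x"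
    by transfer (meson not_ordLeq_iff_ordLess ordIso_Well_orderD ordLess_imp_ordLeq)
  show "x \<le> x"
    by transfer (simp add: ordIso_iff_ordLeq)
  show "x \<le> y \<Longrightarrow> y \<le> z \<Longrightarrow> x \<le> z"
    by transfer (rule ordLeq_transitive)
  show "x \<le> y \<Longrightarrow> y \<le> x \<Longrightarrow> x = y"
    by transfer (simp add: ordIso_iff_ordLeq)
  show "x \<le> y \<or> y \<le> x"
    by transfer (meson ordIso_Well_orderD ordLeq_total)
next
  fix P :: "ordinal \<Rightarrow> bool" and a :: ordinal
  assume step: "\<And>x. (\<And>y. y < x \<Longrightarrow> P y) \<Longrightarrow> P x"
  have "r =o r \<longrightarrow> P (abs_ordinal r)" for r
  proof (induction r rule: wf_induct[OF wf_ordLess])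
    case (1 r)
    show ?case
    proof
      assume r: "r =o r"
      show "P (abs_ordinal r)"
      proof (rule step)
        fix y assume y: "y < abs_ordinal r"
        obtain s where s: "s =o s" "y = abs_ordinal s"
          by (induction y rule: ordinal.abs_induct) blast
        have "s <o r"
          using y s r by (simp add: less_ordinal.abs_eq)
        then show "P y"
          using 1 s by blast
      qed
    qed
  qed
  then show "P a"
    by (induction a rule: ordinal.abs_induct) blast
qed

end

instantiation ordinal :: zero
begin
lift_definition zero_ordinal :: ordinal is "{} :: nat set rel"
  by (rule ordIso_reflexive) simp
instance ..
end

definition ord_succ :: "ordinal \<Rightarrow> ordinal" where
  "ord_succ \<alpha> = (LEAST \<beta>. \<alpha> < \<beta>)"

definition ord_sup :: "ordinal set \<Rightarrow> ordinal" where
  "ord_sup A = (LEAST \<beta>. \<forall>\<alpha>\<in>A. \<alpha> \<le> \<beta>)"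

text \<open>\<open>natLeq\<close> is the usual order on \<open>nat\<close>, here copied along \<open>n \<mapsto> {n}\<close>.\<close>

lift_definition ord_omega :: ordinal is "dir_image natLeq (\<lambda>n. {n})"
  by (rule ordIso_reflexive, rule Well_order_dir_image[OF natLeq_Well_order]) (simp add: inj_on_def)

subsection \<open>Bounded families\<close>

definition init_seg :: "nat set rel \<Rightarrow> nat set \<Rightarrow> ordinal" where
  "init_seg r a = abs_ordinal (Restr r (underS r a))"

lemma ordinal_cases:
  obtains r where "Well_order r" "\<alpha> = abs_ordinal r"
  by (induction \<alpha> rule: ordinal.abs_induct) (blast dest: ordIso_Well_orderD)

lemma below_eq_init_seg:
  assumes "Well_order r"
  shows "{\<beta>. \<beta> < abs_ordinal r} = init_seg r ` Field r"
proof -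
  have r: "r =o r" using assms by (rule ordIso_reflexive)
  have W: "Restr r (underS r a) =o Restr r (underS r a)" for a
    by (rule ordIso_reflexive) (rule Well_order_Restr[OF assms])
  show ?thesis
  proof (intro equalityI subsetI)
    fix \<beta> assume "\<beta> \<in> {\<beta>. \<beta> < abs_ordinal r}"
    moreover obtain s where s: "Well_order s" "\<beta> = abs_ordinal s"
      by (rule ordinal_cases)
    ultimately have "s <o r"
      using r by (simp add: less_ordinal.abs_eq ordIso_reflexive)
    then obtain a where "a \<in> Field r" "s =o Restr r (underS r a)"
      using ordLess_iff_ordIso_Restr[OF assms s(1)] by blast
    then show "\<beta> \<in> init_seg r ` Field r"
      unfolding init_seg_def s(2) using Quotient_rel_abs[OF Quotient_ordinal] by blast
  next
    fix \<beta> assume "\<beta> \<in> init_seg r ` Field r"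
    then obtain a where a: "a \<in> Field r" "\<beta> = init_seg r a" by blast
    have "Restr r (underS r a) <o r"
      using underS_Restr_ordLess[OF assms] a(1) by blast
    then show "\<beta> \<in> {\<beta>. \<beta> < abs_ordinal r}"
      using a(2) r W by (simp add: init_seg_def less_ordinal.abs_eq)
  qed
qed

lemma card_below: "|{\<beta>::ordinal. \<beta> < \<alpha>}| \<le>o |UNIV :: nat set set|"
proof -
  obtain r where r: "Well_order r" "\<alpha> = abs_ordinal r" by (rule ordinal_cases)
  have "|init_seg r ` Field r| \<le>o |Field r|" by (rule card_of_image)
  also have "|Field r| \<le>o |UNIV :: nat set set|" by (rule card_of_mono1) simp
  finally show ?thesis unfolding r(2) below_eq_init_seg[OF r(1)] .
qed

lemma ordinal_not_small: "\<not> |UNIV :: ordinal set| \<le>o |UNIV :: nat set set|"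
proof
  assume "|UNIV :: ordinal set| \<le>o |UNIV :: nat set set|"
  then obtain f :: "ordinal \<Rightarrow> nat set" where f: "inj f"
    using card_of_ordLeq[of "UNIV :: ordinal set" "UNIV :: nat set set"] by auto
  define R where "R = {(x, y::ordinal). x \<le> y}"
  have FR: "Field R = UNIV" unfolding R_def Field_def by auto
  have "R - Id = {(x, y). x < y}" unfolding R_def by auto
  then have "wf (R - Id)" by (simp add: wf)
  moreover have "refl R" "trans R" "antisym R" "total R"
    by (auto simp: R_def refl_on_def trans_def antisym_def total_on_def)
  ultimately have "Well_order R"
    unfolding well_order_on_def linear_order_on_def partial_order_on_def preorder_on_def FR
    by simp
  then have S: "Well_order (dir_image R f)" (is "Well_order ?S")
    using Well_order_dir_image f FR by metis
  have FS: "Field ?S = range f" using FR by (simp add: dir_image_Field)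
  have ui: "underS ?S (f \<beta>) = f ` {\<gamma>. \<gamma> < \<beta>}" for \<beta>
    using f unfolding underS_def dir_image_def R_def
    by (fastforce simp: inj_eq le_less)
  define g where "g \<beta> = init_seg ?S (f \<beta>)" for \<beta>
  define \<sigma> where "\<sigma> = abs_ordinal ?S"
  have g_less: "g \<beta> < \<sigma>" for \<beta>
    using below_eq_init_seg[OF S] FS unfolding g_def \<sigma>_def by blast
  have g_mono: "g \<beta> < g \<gamma>" if "\<beta> < \<gamma>" for \<beta> \<gamma>
  proof -
    have "underS ?S (f \<beta>) \<subset> underS ?S (f \<gamma>)"
    proof -
      have "{\<delta>. \<delta> < \<beta>} \<subset> {\<delta>. \<delta> < \<gamma>}" using that by auto
      then show ?thesis
        unfolding ui using f by (simp add: inj_image_eq_iff inj_image_subset_iff psubset_eq)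
    qed
    moreover have "wo_rel ?S" using S by (simp add: wo_rel_def)
    ultimately have "Restr ?S (underS ?S (f \<beta>)) <o Restr ?S (underS ?S (f \<gamma>))"
      by (simp add: ofilter_subset_ordLess[OF S, symmetric] wo_rel.underS_ofilter)
    then show ?thesis
      unfolding g_def init_seg_def
      by (subst less_ordinal.abs_eq) (auto intro: ordIso_reflexive Well_order_Restr[OF S])
  qed
  have "\<beta> \<le> g \<beta>" for \<beta>
  proof (induction \<beta> rule: less_induct)
    case (less \<beta>)
    show ?case
    proof (rule ccontr)
      assume "\<not> \<beta> \<le> g \<beta>"
      then have "g \<beta> < \<beta>" by simp
      then show False using less[of "g \<beta>"] g_mono[of "g \<beta>" \<beta>] by simp
    qed
  qed
  then show False using g_less[of \<sigma>] by (meson leD)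
qed

lemma ordinal_bounded:
  assumes "|A :: ordinal set| \<le>o |UNIV :: nat set set|"
  shows "\<exists>\<beta>. \<forall>\<alpha>\<in>A. \<alpha> < \<beta>"
proof (rule ccontr)
  assume "\<not> ?thesis"
  then have U: "UNIV = (\<Union>\<alpha>\<in>A. insert \<alpha> {\<beta>. \<beta> < \<alpha>})"
    by (force simp: not_less le_less)
  have inf: "infinite (UNIV :: nat set set)"
    by (simp add: Finite_Set.finite_set)
  have "|insert \<alpha> {\<beta>. \<beta> < \<alpha>}| \<le>o |UNIV :: nat set set|" for \<alpha> :: ordinal
  proof -
    have "|{\<alpha>} \<union> {\<beta>. \<beta> < \<alpha>}| \<le>o |UNIV :: nat set set|"
      by (rule card_of_Un_ordLeq_infinite_Field[OF _ _ card_below card_of_Card_order])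
         (simp_all add: inf card_of_singl_ordLeq Field_card_of)
    then show ?thesis by simp
  qed
  then have "|\<Union>\<alpha>\<in>A. insert \<alpha> {\<beta>. \<beta> < \<alpha>}| \<le>o |UNIV :: nat set set|"
    by (intro card_of_UNION_ordLeq_infinite[OF inf assms]) blast
  then show False using U ordinal_not_small by simp
qed

lemma less_ord_succ: "\<alpha> < ord_succ \<alpha>"
proof -
  have "infinite (UNIV :: nat set set)" by (simp add: Finite_Set.finite_set)
  then have "\<exists>\<beta>. \<forall>\<gamma>\<in>{\<alpha>}. \<gamma> < \<beta>"
    by (intro ordinal_bounded) (simp add: card_of_singl_ordLeq)
  then show ?thesis unfolding ord_succ_def by (auto intro: LeastI)
qed

lemma ord_succ_le_iff: "ord_succ \<alpha> \<le> \<beta> \<longleftrightarrow> \<alpha> < \<beta>"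
  using less_ord_succ[of \<alpha>] by (auto simp: ord_succ_def intro: Least_le)

lemma ord_sup_le_iff:
  assumes "|A| \<le>o |UNIV :: nat set set|"
  shows "ord_sup A \<le> \<beta> \<longleftrightarrow> (\<forall>\<alpha>\<in>A. \<alpha> \<le> \<beta>)"
proof -
  have "\<exists>\<beta>. \<forall>\<alpha>\<in>A. \<alpha> \<le> \<beta>"
    using ordinal_bounded[OF assms] less_imp_le by blast
  then have "\<forall>\<alpha>\<in>A. \<alpha> \<le> ord_sup A"
    unfolding ord_sup_def by (rule LeastI_ex)
  then show ?thesis
    by (auto simp: ord_sup_def intro: Least_le order_trans)
qed


section \<open>Board and winning chains\<close>

typedef cell = "{(a::rat, j::int). \<exists>k::int. a = of_int k + of_int j / 2}"
  morphisms coords Cell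
  by auto

abbreviation xc :: "cell \<Rightarrow> rat" where "xc h \<equiv> fst (coords h)"
abbreviation yc :: "cell \<Rightarrow> int" where "yc h \<equiv> snd (coords h)"

definition adjacent :: "cell \<Rightarrow> cell \<Rightarrow> bool" where
  "adjacent h h' \<longleftrightarrow>
     yc h = yc h' \<and> \<bar>xc h - xc h'\<bar> = 1 \<or>
     \<bar>yc h - yc h'\<bar> = 1 \<and> \<bar>xc h - xc h'\<bar> = 1 / 2"

datatype player = Red | Blue

fun opponent :: "player \<Rightarrow> player" where
  "opponent Red = Blue"
| "opponent Blue = Red"

fun winning_wrt :: "player \<Rightarrow> (int \<Rightarrow> cell) \<Rightarrow> cell \<Rightarrow> bool" where
  "winning_wrt Red r h\<^sub>0 \<longleftrightarrow> (\<exists>M. \<forall>m\<ge>M.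
     xc (r m) > xc h\<^sub>0 \<and> yc (r m) > yc h\<^sub>0 \<and> xc (r (- m)) < xc h\<^sub>0 \<and> yc (r (- m)) < yc h\<^sub>0)"
| "winning_wrt Blue b h\<^sub>0 \<longleftrightarrow> (\<exists>M. \<forall>m\<ge>M.
     xc (b m) < xc h\<^sub>0 \<and> yc (b m) > yc h\<^sub>0 \<and> xc (b (- m)) > xc h\<^sub>0 \<and> yc (b (- m)) < yc h\<^sub>0)"

definition contains_winning_chain :: "player \<Rightarrow> cell set \<Rightarrow> bool" where
  "contains_winning_chain P S \<longleftrightarrow>
     (\<exists>r. (\<forall>n. r n \<in> S) \<and> (\<forall>n. adjacent (r n) (r (n + 1))) \<and> (\<forall>h\<^sub>0. winning_wrt P r h\<^sub>0))"


section \<open>The game\<close>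

type_synonym config = "cell \<Rightarrow> player option"

text \<open>A configuration with the player to move; also serves as a game, with that initial position.\<close>
type_synonym position = "config \<times> player"

definition cells_of :: "player \<Rightarrow> position \<Rightarrow> cell set" where
  "cells_of P p = {h. fst p h = Some P}"

definition has_won :: "player \<Rightarrow> position \<Rightarrow> bool" where
  "has_won P p \<longleftrightarrow> contains_winning_chain P (cells_of P p)"

definition successors :: "position \<Rightarrow> position set" where
  "successors p =
     (if has_won Red p \<or> has_won Blue p then {}
      else {((fst p)(h := Some (snd p)), opponent (snd p)) | h. fst p h = None})"

text \<open>
  A play is a maximal sequence of positions; one that ends (because a player has won or the board
  is full) is represented by repeating its last position forever.
\<close>
definition plays :: "position \<Rightarrow> (nat \<Rightarrow> position) set" where
  "plays g = {\<pi>. \<pi> 0 = g \<and>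
     (\<forall>n. \<pi> (Suc n) \<in> successors (\<pi> n) \<or> successors (\<pi> n) = {} \<and> \<pi> (Suc n) = \<pi> n)}"

text \<open>A play can also be won in the limit, without being won at any finite stage.\<close>
definition won_plays :: "player \<Rightarrow> position \<Rightarrow> (nat \<Rightarrow> position) set" where
  "won_plays P g = {\<pi> \<in> plays g. contains_winning_chain P (\<Union>n. cells_of P (\<pi> n))}"

definition plays_through :: "position \<Rightarrow> position \<Rightarrow> (nat \<Rightarrow> position) set" where
  "plays_through g v = {\<pi> \<in> plays g. \<exists>n. \<pi> n = v}"

text \<open>
  A position can be reached by several orders of moves. As finite intersections are taken, this is
  the same topology as that with basis the sets of plays with a given finite initial part.
\<close>
definition play_topology :: "position \<Rightarrow> (nat \<Rightarrow> position) topology" where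
  "play_topology g = topology_generated_by (range (plays_through g))"

definition open_for :: "player \<Rightarrow> position \<Rightarrow> bool" where
  "open_for P g \<longleftrightarrow> openin (play_topology g) (won_plays P g)"


section \<open>Game values\<close>

text \<open>
  The recursion for the value for the open player \<open>P\<close>, with \<open>None\<close> for an undefined value.
  In the clause for the opponent's move, finished games (won by the opponent, or with a full board)
  are excluded: they have no successors and would otherwise get the empty supremum as value.
  By lemma \<open>ex1_valuation\<close> the recursion has exactly one solution.
\<close>
definition is_valuation :: "player \<Rightarrow> (position \<Rightarrow> ordinal option) \<Rightarrow> bool" where
  "is_valuation P v \<longleftrightarrow> (\<forall>p. v p =
     (if has_won P p then Some 0
      else if snd p = P \<and> (\<exists>q\<in>successors p. v q \<noteq> None)
        then Some (ord_succ (LEAST \<alpha>. \<exists>q\<in>successors p. v q = Some \<alpha>))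
      else if snd p \<noteq> P \<and> successors p \<noteq> {} \<and> (\<forall>q\<in>successors p. v q \<noteq> None)
        then Some (ord_sup {\<alpha>. \<exists>q\<in>successors p. v q = Some \<alpha>})
      else None))"

definition game_value :: "player \<Rightarrow> position \<Rightarrow> ordinal option" where
  "game_value P = (THE v. is_valuation P v)"

lemma countable_successors: "countable (successors p)"
proof -
  have "inj coords" by (simp add: coords_inject inj_on_def)
  then have "countable (UNIV :: cell set)"
    by (metis countableI_type countable_image_inj_eq)
  then have "countable ((\<lambda>h. ((fst p)(h := Some (snd p)), opponent (snd p))) ` UNIV)" by simp
  then show ?thesis
    by (rule countable_subset[rotated]) (auto simp: successors_def)
qed

lemma successor_values_small:
  "|{\<alpha>. \<exists>q\<in>successors p. v q = Some (\<alpha>::ordinal)}| \<le>o |UNIV :: nat set set|"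
proof -
  have "countable {\<alpha>. \<exists>q\<in>successors p. v q = Some \<alpha>}"
    by (rule countable_subset[OF _ countable_image[OF countable_successors[of p], of "the \<circ> v"]])
       force
  then obtain f :: "ordinal \<Rightarrow> nat" where "inj_on f {\<alpha>. \<exists>q\<in>successors p. v q = Some \<alpha>}"
    unfolding countable_def by blast
  then have "inj_on (\<lambda>\<alpha>. {f \<alpha>}) {\<alpha>. \<exists>q\<in>successors p. v q = Some \<alpha>}"
    by (simp add: inj_on_def)
  then show ?thesis
    by (intro card_of_ordLeq[THEN iffD1] exI conjI) auto
qed

inductive value_le :: "player \<Rightarrow> position \<Rightarrow> ordinal \<Rightarrow> bool" for P where
  won: "has_won P p \<Longrightarrow> value_le P p \<alpha>"
| own: "\<not> has_won P p \<Longrightarrow> snd p = P \<Longrightarrow> q \<in> successors p \<Longrightarrow> value_le P q \<beta> \<Longrightarrow> \<beta> < \<alpha> \<Longrightarrow> value_le P p \<alpha>"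
| opp: "\<not> has_won P p \<Longrightarrow> snd p \<noteq> P \<Longrightarrow> successors p \<noteq> {} \<Longrightarrow>
    (\<And>q. q \<in> successors p \<Longrightarrow> value_le P q \<alpha>) \<Longrightarrow> value_le P p \<alpha>"

lemma value_le_mono: "value_le P p \<alpha> \<Longrightarrow> \<alpha> \<le> \<beta> \<Longrightarrow> value_le P p \<beta>"
proof (induction arbitrary: \<beta> rule: value_le.induct)
  case (own p q \<gamma> \<alpha>)
  then show ?case by (meson less_le_trans value_le.own)
qed (auto intro: value_le.intros)

lemma zero_le_ordinal: "(0::ordinal) \<le> \<alpha>"
  by transfer (auto simp: ordLeq_def embed_def dest: ordIso_Well_orderD)

lemma valuation_unique:
  assumes "is_valuation P v"
  shows "v p = Some \<alpha> \<Longrightarrow> value_le P p \<alpha>"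
    and "value_le P p \<alpha> \<Longrightarrow> \<exists>\<beta>\<le>\<alpha>. v p = Some \<beta>"
proof -
  note eq = assms[unfolded is_valuation_def, rule_format]
  have own: "value_le P p \<alpha>" if IH: "\<And>\<beta> q. \<beta> < \<alpha> \<Longrightarrow> v q = Some \<beta> \<Longrightarrow> value_le P q \<beta>"
    and v: "v p = Some \<alpha>" and t: "snd p = P" for p \<alpha>
  proof (cases "has_won P p")
    case False
    define \<beta> where "\<beta> = (LEAST \<alpha>. \<exists>q\<in>successors p. v q = Some \<alpha>)"
    have "\<exists>q\<in>successors p. v q \<noteq> None"
      using v t False eq[of p] by (auto split: if_splits)
    then have "\<exists>\<alpha>. \<exists>q\<in>successors p. v q = Some \<alpha>" by blast
    then have "\<exists>q\<in>successors p. v q = Some \<beta>"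
      unfolding \<beta>_def by (rule LeastI_ex)
    then obtain q where q: "q \<in> successors p" "v q = Some \<beta>" by blast
    have "v p = Some (ord_succ \<beta>)"
      using v t False eq[of p] unfolding \<beta>_def by (auto split: if_splits)
    then have "\<beta> < \<alpha>"
      using v less_ord_succ by simp
    then show ?thesis
      using IH q t False value_le.own by blast
  qed (rule value_le.won)
  show "value_le P p \<alpha>" if "v p = Some \<alpha>" for p \<alpha>
    using that
  proof (induction \<alpha> arbitrary: p rule: less_induct)
    case (less \<alpha>)
    show ?case
    proof (cases "has_won P p \<or> snd p = P")
      case True
      then show ?thesis using less own value_le.won by blast
    next
      case False
      have s: "successors p \<noteq> {}" "\<forall>q\<in>successors p. v q \<noteq> None"
        using less.prems False eq[of p] by (auto split: if_splits)
      have \<alpha>: "\<alpha> = ord_sup {\<alpha>. \<exists>q\<in>successors p. v q = Some \<alpha>}"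
        using less.prems False eq[of p] by (auto split: if_splits)
      have "value_le P q \<alpha>" if q: "q \<in> successors p" for q
      proof -
        obtain \<beta> where \<beta>: "v q = Some \<beta>" using s q by auto
        have "\<beta> \<le> \<alpha>"
          using ord_sup_le_iff[OF successor_values_small[of p v], of \<alpha>] \<alpha> \<beta> q by auto
        moreover have "snd q = P"
          using q False by (cases P; cases "snd p") (auto simp: successors_def split: if_splits)
        then have "value_le P q \<beta>"
          using own[OF _ \<beta>] less.IH \<open>\<beta> \<le> \<alpha>\<close> by (meson less_le_trans)
        ultimately show ?thesis by (rule value_le_mono[rotated])
      qed
      then show ?thesis using False s value_le.opp by blast
    qed
  qed
  show "\<exists>\<beta>\<le>\<alpha>. v p = Some \<beta>" if "value_le P p \<alpha>" for p \<alpha>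
    using that
  proof (induction rule: value_le.induct)
    case (won p \<alpha>)
    then show ?case using eq[of p] zero_le_ordinal by auto
  next
    case (own p q \<beta> \<alpha>)
    then obtain \<gamma> where \<gamma>: "\<gamma> \<le> \<beta>" "v q = Some \<gamma>" by blast
    have "(LEAST \<alpha>. \<exists>q\<in>successors p. v q = Some \<alpha>) \<le> \<gamma>"
      by (rule Least_le) (use \<gamma> own in blast)
    then have "ord_succ (LEAST \<alpha>. \<exists>q\<in>successors p. v q = Some \<alpha>) \<le> \<alpha>"
      using \<gamma> own by (auto simp: ord_succ_le_iff)
    moreover have "v p = Some (ord_succ (LEAST \<alpha>. \<exists>q\<in>successors p. v q = Some \<alpha>))"
      using eq[of p] own \<gamma> by auto
    ultimately show ?case by blast
  next
    case (opp p \<alpha>)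
    have "\<forall>q\<in>successors p. v q \<noteq> None" using opp by fastforce
    then have "v p = Some (ord_sup {\<alpha>. \<exists>q\<in>successors p. v q = Some \<alpha>})"
      using eq[of p] opp by auto
    moreover have "ord_sup {\<alpha>. \<exists>q\<in>successors p. v q = Some \<alpha>} \<le> \<alpha>"
      unfolding ord_sup_le_iff[OF successor_values_small] using opp by fastforce
    ultimately show ?case by blast
  qed
qed

definition least_value :: "player \<Rightarrow> position \<Rightarrow> ordinal option" where
  "least_value P p = (if \<exists>\<alpha>. value_le P p \<alpha> then Some (LEAST \<alpha>. value_le P p \<alpha>) else None)"

lemma least_value_Some:
  "least_value P p = Some \<alpha> \<longleftrightarrow> value_le P p \<alpha> \<and> (\<forall>\<beta>. value_le P p \<beta> \<longrightarrow> \<alpha> \<le> \<beta>)"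
  unfolding least_value_def
  by (auto intro: LeastI Least_le Least_equality)

lemma least_value_neq_None: "least_value P p \<noteq> None \<longleftrightarrow> (\<exists>\<alpha>. value_le P p \<alpha>)"
  by (simp add: least_value_def)

lemma is_valuation_least_value: "is_valuation P (least_value P)"
  unfolding is_valuation_def
proof
  fix p
  let ?v = "least_value P"
  let ?A = "{\<alpha>. \<exists>q\<in>successors p. ?v q = Some \<alpha>}"
  consider (won) "has_won P p" | (own) "\<not> has_won P p" "snd p = P" | (opp) "\<not> has_won P p" "snd p \<noteq> P"
    by blast
  then show "?v p =
     (if has_won P p then Some 0
      else if snd p = P \<and> (\<exists>q\<in>successors p. ?v q \<noteq> None)
        then Some (ord_succ (LEAST \<alpha>. \<exists>q\<in>successors p. ?v q = Some \<alpha>))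
      else if snd p \<noteq> P \<and> successors p \<noteq> {} \<and> (\<forall>q\<in>successors p. ?v q \<noteq> None)
        then Some (ord_sup ?A)
      else None)"
  proof cases
    case won
    then show ?thesis by (simp add: least_value_Some zero_le_ordinal value_le.won)
  next
    case own
    have iff: "value_le P p \<alpha> \<longleftrightarrow> (\<exists>q\<in>successors p. \<exists>\<beta><\<alpha>. value_le P q \<beta>)" for \<alpha>
      using own by (subst value_le.simps) blast
    show ?thesis
    proof (cases "\<exists>q\<in>successors p. ?v q \<noteq> None")
      case True
      define \<mu> where "\<mu> = (LEAST \<alpha>. \<exists>q\<in>successors p. ?v q = Some \<alpha>)"
      have "\<exists>\<alpha>. \<exists>q\<in>successors p. ?v q = Some \<alpha>" using True by blast
      then have "\<exists>q\<in>successors p. ?v q = Some \<mu>" unfolding \<mu>_def by (rule LeastI_ex)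
      then obtain q where q: "q \<in> successors p" "value_le P q \<mu>" by (auto simp: least_value_Some)
      have min: "\<mu> \<le> \<beta>" if r: "r \<in> successors p" "value_le P r \<beta>" for r \<beta>
      proof -
        obtain \<gamma> where \<gamma>: "?v r = Some \<gamma>"
          using r least_value_neq_None[of P r] by auto
        then have "\<mu> \<le> \<gamma>" unfolding \<mu>_def using r by (intro Least_le) blast
        also have "\<gamma> \<le> \<beta>" using \<gamma> r by (simp add: least_value_Some)
        finally show ?thesis .
      qed
      have "?v p = Some (ord_succ \<mu>)"
        unfolding least_value_Some iff
        using q min less_ord_succ by (meson le_less_trans ord_succ_le_iff)
      then show ?thesis using own True unfolding \<mu>_def by simp
    next
      case False
      then have "?v p = None"
        using iff by (auto simp: least_value_def split: if_splits)
      then show ?thesis using own False by auto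
    qed
  next
    case opp
    have iff: "value_le P p \<alpha> \<longleftrightarrow> successors p \<noteq> {} \<and> (\<forall>q\<in>successors p. value_le P q \<alpha>)" for \<alpha>
      using opp by (subst value_le.simps) blast
    show ?thesis
    proof (cases "successors p \<noteq> {} \<and> (\<forall>q\<in>successors p. ?v q \<noteq> None)")
      case True
      have *: "value_le P q \<alpha> \<longleftrightarrow> (\<exists>\<beta>\<le>\<alpha>. ?v q = Some \<beta>)" if "q \<in> successors p" for q \<alpha>
      proof -
        obtain \<gamma> where \<gamma>: "?v q = Some \<gamma>" using True \<open>q \<in> successors p\<close> by auto
        then have "value_le P q \<alpha> \<longleftrightarrow> \<gamma> \<le> \<alpha>"
          using value_le_mono[of P q \<gamma> \<alpha>] by (auto simp: least_value_Some)
        then show ?thesis using \<gamma> by auto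
      qed
      have "value_le P p \<alpha> \<longleftrightarrow> ord_sup ?A \<le> \<alpha>" for \<alpha>
      proof -
        have "value_le P p \<alpha> \<longleftrightarrow> (\<forall>q\<in>successors p. \<exists>\<beta>\<le>\<alpha>. ?v q = Some \<beta>)"
          using True * iff by simp
        also have "\<dots> \<longleftrightarrow> (\<forall>\<beta>\<in>?A. \<beta> \<le> \<alpha>)"
        proof
          assume l: "\<forall>q\<in>successors p. \<exists>\<beta>\<le>\<alpha>. ?v q = Some \<beta>"
          show "\<forall>\<beta>\<in>?A. \<beta> \<le> \<alpha>"
          proof
            fix \<beta> assume "\<beta> \<in> ?A"
            then obtain q where "q \<in> successors p" "?v q = Some \<beta>" by blast
            then show "\<beta> \<le> \<alpha>" using l by fastforce
          qed
        next
          assume r: "\<forall>\<beta>\<in>?A. \<beta> \<le> \<alpha>"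
          show "\<forall>q\<in>successors p. \<exists>\<beta>\<le>\<alpha>. ?v q = Some \<beta>"
          proof
            fix q assume q: "q \<in> successors p"
            then obtain \<beta> where "?v q = Some \<beta>" using True by auto
            then show "\<exists>\<beta>\<le>\<alpha>. ?v q = Some \<beta>" using q r by blast
          qed
        qed
        finally show ?thesis
          unfolding ord_sup_le_iff[OF successor_values_small] .
      qed
      then have "?v p = Some (ord_sup ?A)" by (simp add: least_value_Some)
      then show ?thesis using opp True by simp
    next
      case False
      then have "?v p = None"
        using iff by (auto simp: least_value_def split: if_splits)
      then show ?thesis using opp False by auto
    qed
  qed
qed

lemma ex1_valuation: "\<exists>!v. is_valuation P v"
proof (rule ex1I)
  show "is_valuation P (least_value P)" by (rule is_valuation_least_value)
  fix v assume v: "is_valuation P v"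
  show "v = least_value P"
  proof
    fix p
    show "v p = least_value P p"
    proof (cases "v p")
      case None
      then show ?thesis using valuation_unique(2)[OF v] by (fastforce simp: least_value_def)
    next
      case (Some \<alpha>)
      then have "least_value P p = Some \<alpha>"
        using valuation_unique[OF v, of p] by (fastforce simp: least_value_Some)
      then show ?thesis using Some by simp
    qed
  qed
qed

lemma is_valuation_game_value: "is_valuation P (game_value P)"
  unfolding game_value_def by (rule theI'[OF ex1_valuation])

definition hex_omega_one :: ordinal where
  "hex_omega_one = ord_sup {\<alpha>. \<exists>P g. open_for P g \<and> game_value P g = Some \<alpha>}"

unbundle no cardinal_syntax

end

theory Submission
  imports Defs
begin

text \<open>
  Two disjoint sets of cells cannot both contain winning chains. Hence a player with a winning
  strategy need not mind stones of the opponent outside the cells he intends to use, and, by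
  induction on the value, every position with a value is won within some fixed finite set of cells.
  So all values are finite. A row of \<open>n\<close> bridges, each of which Red must and can complete with
  one stone, gives an open game of value \<open>n\<close>.
\<close>

section \<open>Finite ordinals\<close>

text \<open>Only the supremum over the infinitely many moves of the opponent could turn finite
  values into an infinite one; a finite region reduces it to a maximum over finitely many of these
  moves. The statement about disjoint chains is settled by counting signed crossings of a path with
  a ray, for finite pieces of the chains whose ends are cut so that each piece passes the other. The
  value of a row of bridges is bounded from below by counting stones: a value of at most
  \<open>n\<close> lets Red complete a chain with at most \<open>n\<close> more stones, while every
  bridge lacks one. Filling all other cells makes every play of these games finite, from which
  openness follows.\<close>

definition fin_ord :: "nat \<Rightarrow> ordinal" where
  "fin_ord n = (ord_succ ^^ n) 0"

lemma fin_ord_0 [simp]: "fin_ord 0 = 0"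
  and fin_ord_Suc [simp]: "fin_ord (Suc n) = ord_succ (fin_ord n)"
  by (simp_all add: fin_ord_def)

lemma strict_mono_fin_ord: "strict_mono fin_ord"
  by (rule strict_mono_Suc_iff[THEN iffD2]) (simp add: less_ord_succ)

lemma less_ord_succ_iff: "\<beta> < ord_succ \<alpha> \<longleftrightarrow> \<beta> \<le> \<alpha>"
  using ord_succ_le_iff[of \<alpha> \<beta>] by (meson not_less)

lemma less_fin_ord_iff: "\<beta> < fin_ord n \<longleftrightarrow> (\<exists>m<n. \<beta> = fin_ord m)"
proof (induction n)
  case 0
  then show ?case using zero_le_ordinal by (simp add: not_less)
next
  case (Suc n)
  then show ?case by (auto simp: less_ord_succ_iff le_less less_Suc_eq)
qed

text \<open>The finite ordinals form an initial segment, so any other ordinal lies above all of them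
  and has infinitely many predecessors.\<close>

lemma fin_ord_if_finite_below:
  assumes "finite {\<gamma>. \<gamma> < \<beta>}"
  shows "\<exists>n. \<beta> = fin_ord n"
proof (rule ccontr)
  assume "\<nexists>n. \<beta> = fin_ord n"
  then have neq: "\<beta> \<noteq> fin_ord n" for n by blast
  have "fin_ord n < \<beta>" for n
  proof (rule ccontr)
    assume "\<not> fin_ord n < \<beta>"
    then have "\<beta> < fin_ord n" using neq[of n] by simp
    then show False using neq by (auto simp: less_fin_ord_iff)
  qed
  then have "range fin_ord \<subseteq> {\<gamma>. \<gamma> < \<beta>}" by blast
  then have "finite (range fin_ord)" using assms finite_subset by blast
  then show False
    using strict_mono_imp_inj_on[OF strict_mono_fin_ord] finite_imageD by blast
qed

lemma less_ord_omega_iff: "\<beta> < ord_omega \<longleftrightarrow> (\<exists>n. \<beta> = fin_ord n)"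
proof -
  define R :: "nat set rel" where "R = dir_image natLeq (\<lambda>n. {n})"
  have R: "Well_order R"
    unfolding R_def by (rule Well_order_dir_image[OF natLeq_Well_order]) (simp add: inj_on_def)
  have om: "ord_omega = abs_ordinal R"
    by (simp add: ord_omega_def R_def)
  have FR: "Field R = range (\<lambda>n. {n})"
    unfolding R_def by (simp add: dir_image_Field Field_natLeq)
  have us: "underS R {n} = (\<lambda>n. {n}) ` {..<n}" for n
    unfolding underS_def R_def dir_image_def natLeq_def by auto
  have fin: "\<exists>n. \<beta> = fin_ord n" if "\<beta> < ord_omega" for \<beta>
  proof -
    have "\<beta> \<in> init_seg R ` range (\<lambda>n. {n})"
      using that unfolding om FR[symmetric] below_eq_init_seg[OF R, symmetric] by simp
    then obtain n where n: "\<beta> = init_seg R {n}" by auto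
    have "Well_order (Restr R (underS R {n}))" by (rule Well_order_Restr[OF R])
    from below_eq_init_seg[OF this]
    have "{\<gamma>. \<gamma> < \<beta>} = init_seg (Restr R (underS R {n})) ` Field (Restr R (underS R {n}))"
      by (simp add: n init_seg_def)
    moreover have "finite (Field (Restr R (underS R {n})))"
      by (rule finite_subset[of _ "underS R {n}"]) (auto simp: Field_def us)
    ultimately show ?thesis by (simp add: fin_ord_if_finite_below)
  qed
  have mono: "init_seg R {m} < init_seg R {n}" if "m < n" for m n
  proof -
    have "underS R {m} \<subset> underS R {n}"
      unfolding us using that by (auto simp: image_iff)
    moreover have "wo_rel R" using R by (simp add: wo_rel_def)
    ultimately have "(Restr R (underS R {m}), Restr R (underS R {n})) \<in> ordLess"
      by (simp add: ofilter_subset_ordLess[OF R, symmetric] wo_rel.underS_ofilter)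
    then show ?thesis
      unfolding init_seg_def
      by (subst less_ordinal.abs_eq) (auto intro: ordIso_reflexive Well_order_Restr[OF R])
  qed
  then have "strict_mono (\<lambda>n. init_seg R {n})" by (simp add: strict_mono_def)
  then have "inj (\<lambda>n. init_seg R {n})" by (rule strict_mono_imp_inj_on)
  then have inf: "infinite (range (\<lambda>n. init_seg R {n}))" by (simp add: finite_image_iff)
  \<comment> \<open>Comparison by counting: infinitely many ordinals lie below
    \<open>ord_omega\<close>, but only \<open>n\<close> below \<open>fin_ord n\<close>.\<close>
  have "fin_ord n < ord_omega" for n
  proof (rule ccontr)
    assume *: "\<not> fin_ord n < ord_omega"
    have "range (\<lambda>n. init_seg R {n}) \<subseteq> {\<beta>. \<beta> < ord_omega}"
      unfolding om below_eq_init_seg[OF R] FR by blast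
    also have "\<dots> \<subseteq> fin_ord ` {..<n}"
    proof
      fix \<beta> assume "\<beta> \<in> {\<beta>. \<beta> < ord_omega}"
      then have "\<beta> < fin_ord n" using * by simp
      then show "\<beta> \<in> fin_ord ` {..<n}" by (auto simp: less_fin_ord_iff)
    qed
    finally show False using inf finite_subset by blast
  qed
  then show ?thesis using fin by blast
qed


section \<open>Disjoint winning chains do not exist\<close>

text \<open>Twice the first coordinate, an integer of the same parity as the second one.\<close>

definition xd :: "cell \<Rightarrow> int" where
  "xd h = \<lfloor>2 * xc h\<rfloor>"

lemma of_int_xd: "of_int (xd h) = 2 * xc h" and even_xd_diff: "even (xd h - yc h)"
proof -
  obtain a j where h: "coords h = (a, j)" by fastforce
  then obtain k :: int where "a = of_int k + of_int j / 2"
    using coords[of h] by auto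
  then have "2 * xc h = of_int (2 * k + j)" using h by simp
  then have "xd h = 2 * k + j" "of_int (xd h) = 2 * xc h" by (simp_all only: xd_def floor_of_int)
  then show "of_int (xd h) = 2 * xc h" "even (xd h - yc h)" using h by simp_all
qed

lemma cell_eqI: "xd h = xd h' \<Longrightarrow> yc h = yc h' \<Longrightarrow> h = h'"
  using of_int_xd[of h] of_int_xd[of h'] by (simp add: coords_inject[symmetric] prod_eq_iff)

lemma adjacent_iff:
  "adjacent h h' \<longleftrightarrow>
     yc h = yc h' \<and> \<bar>xd h - xd h'\<bar> = 2 \<or> \<bar>yc h - yc h'\<bar> = 1 \<and> \<bar>xd h - xd h'\<bar> = 1"
proof -
  have "of_int \<bar>xd h - xd h'\<bar> = \<bar>2 * (xc h - xc h')\<bar>"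
    by (simp add: of_int_xd)
  also have "\<dots> = 2 * \<bar>xc h - xc h'\<bar>" by (simp only: abs_mult abs_numeral)
  finally have "of_int \<bar>xd h - xd h'\<bar> = 2 * \<bar>xc h - xc h'\<bar>" .
  then have "\<bar>xc h - xc h'\<bar> = of_int \<bar>xd h - xd h'\<bar> / 2" by simp
  then show ?thesis
    unfolding adjacent_def by (simp only: divide_eq_eq) auto
qed

text \<open>Within a row all \<open>xd\<close> have the same parity. Thanks to the gap of 2, a cell
  and a path may each shift \<open>xd\<close> by 1 without passing each other.\<close>

lemma same_row_distance:
  assumes "h \<noteq> h'" "yc h = yc h'"
  shows "\<bar>xd h - xd h'\<bar> \<ge> 2"
proof -
  have "even ((xd h - yc h) - (xd h' - yc h'))"
    by (rule dvd_diff[OF even_xd_diff even_xd_diff])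
  then have "even (xd h - xd h')" using assms(2) by simp
  then obtain w where "xd h - xd h' = 2 * w" by (rule evenE)
  moreover have "xd h \<noteq> xd h'" using assms cell_eqI by blast
  ultimately show ?thesis by presburger
qed

text \<open>
  The signed number of times that the \<open>i\<close>-th step of \<open>b\<close> crosses a ray that starts at \<open>h\<close> and goes
  to the right slightly above the row of \<open>h\<close>. For a path \<open>b\<close> from far below to far above, the sum
  over all steps does not change when \<open>h\<close> moves to an adjacent cell off \<open>b\<close>; it is 1 to the left
  of \<open>b\<close> and 0 to the right.
\<close>

definition crossing :: "(nat \<Rightarrow> cell) \<Rightarrow> cell \<Rightarrow> nat \<Rightarrow> int" where
  "crossing b h i =
     of_bool (yc (b i) = yc h \<and> xd (b i) > xd h \<and> yc (b (Suc i)) = yc h + 1) -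
     of_bool (yc (b (Suc i)) = yc h \<and> xd (b (Suc i)) > xd h \<and> yc (b i) = yc h + 1)"

text \<open>In a common row no cell of \<open>b\<close> fits between \<open>h\<close> and
  \<open>h'\<close>, so the terms agree. If \<open>h'\<close> is one row higher, the two rays
  enclose the part of its row to the right of \<open>h'\<close>; the counts differ by what enters
  this part minus what leaves it, and \<open>b\<close> begins and ends outside.\<close>

lemma sum_crossing_adjacent:
  assumes adj: "adjacent h h'"
    and b: "\<And>i. i < L \<Longrightarrow> adjacent (b i) (b (Suc i))"
    and off: "\<And>i. i \<le> L \<Longrightarrow> b i \<noteq> h" "\<And>i. i \<le> L \<Longrightarrow> b i \<noteq> h'"
    and bot: "yc (b 0) < yc h" "yc (b 0) < yc h'"
    and top: "yc h < yc (b L)" "yc h' < yc (b L)"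
    and le: "yc h \<le> yc h'"
  shows "(\<Sum>i<L. crossing b h i) = (\<Sum>i<L. crossing b h' i)"
proof (cases "yc h = yc h'")
  case True
  have "xd (b i) > xd h \<longleftrightarrow> xd (b i) > xd h'" if "i \<le> L" "yc (b i) = yc h" for i
    using same_row_distance[OF off(1)] same_row_distance[OF off(2)] that adj True
    by (fastforce simp: adjacent_iff)
  then show ?thesis
    unfolding crossing_def by (intro sum.cong refl) (use True in auto)
next
  case False
  then have yh': "yc h' = yc h + 1" and xh': "\<bar>xd h - xd h'\<bar> = 1"
    using adj le by (auto simp: adjacent_iff)
  define S :: "nat \<Rightarrow> int" where "S i = of_bool (yc (b i) = yc h' \<and> xd (b i) > xd h')" for i
  have "crossing b h i - crossing b h' i = S (Suc i) - S i" if i: "i < L" for i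
  proof -
    define X Y X' Y' x y x' where
      defs: "X = xd (b i)" "Y = yc (b i)" "X' = xd (b (Suc i))" "Y' = yc (b (Suc i))"
      "x = xd h" "y = yc h" "x' = xd h'"
    have A: "Y = Y' \<and> \<bar>X - X'\<bar> = 2 \<or> \<bar>Y - Y'\<bar> = 1 \<and> \<bar>X - X'\<bar> = 1" "\<bar>x - x'\<bar> = 1"
      unfolding defs using b[OF i] xh' by (auto simp: adjacent_iff)
    have N: "Y = y \<Longrightarrow> \<bar>X - x\<bar> \<ge> 2" "Y = y + 1 \<Longrightarrow> \<bar>X - x'\<bar> \<ge> 2"
      "Y' = y \<Longrightarrow> \<bar>X' - x\<bar> \<ge> 2" "Y' = y + 1 \<Longrightarrow> \<bar>X' - x'\<bar> \<ge> 2"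
      unfolding defs yh'[symmetric] using i by (auto intro!: same_row_distance off)
    \<comment> \<open>The offset of the path from the cell has absolute value at least 2 before and
      after the step and changes by at most 2, so it keeps its sign. The same holds for
      \<open>down\<close> and \<open>level\<close>.\<close>
    have up: "X > x \<longleftrightarrow> X' > x'" if "Y = y" "Y' = y + 1"
      using A N(1)[OF that(1)] N(4)[OF that(2)] that by arith
    have down: "X' > x \<longleftrightarrow> X > x'" if "Y' = y" "Y = y + 1"
      using A N(3)[OF that(1)] N(2)[OF that(2)] that by arith
    have level: "X > x' \<longleftrightarrow> X' > x'" if "Y = y + 1" "Y' = y + 1"
      using A N(2)[OF that(1)] N(4)[OF that(2)] that by arith
    consider "Y' = Y" | "Y' = Y + 1" | "Y' = Y - 1" using A(1) by arith
    then have "of_bool (Y = y \<and> X > x \<and> Y' = y + 1) - of_bool (Y' = y \<and> X' > x \<and> Y = y + 1) -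
        (of_bool (Y = y + 1 \<and> X > x' \<and> Y' = y + 1 + 1) - of_bool (Y' = y + 1 \<and> X' > x' \<and> Y = y + 1 + 1))
      = of_bool (Y' = y + 1 \<and> X' > x') - (of_bool (Y = y + 1 \<and> X > x') :: int)"
    proof cases
      case 1
      then show ?thesis using level by (cases "Y = y + 1") auto
    next
      case 2
      then show ?thesis using up by (cases "Y = y"; cases "Y = y + 1") auto
    next
      case 3
      then show ?thesis using down by (cases "Y = y + 1"; cases "Y = y + 2") auto
    qed
    then show ?thesis
      unfolding crossing_def S_def yh' defs[symmetric] .
  qed
  then have "(\<Sum>i<L. crossing b h i - crossing b h' i) = (\<Sum>i<L. S (Suc i) - S i)"
    by (intro sum.cong) auto
  also have "\<dots> = S L - S 0" by (rule sum_lessThan_telescope)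
  also have "\<dots> = 0" using bot top by (simp add: S_def)
  finally show ?thesis by (simp add: sum_subtractf)
qed

text \<open>Otherwise the crossing number of \<open>b\<close> would be constant along
  \<open>r\<close>, though it is 1 at \<open>r 0\<close> and 0 at \<open>r K\<close>. The bounds on
  heights keep \<open>r\<close> strictly between the rows of the ends of \<open>b\<close>, as
  invariance demands.\<close>

lemma finite_paths_cross:
  assumes r: "\<And>i. i < K \<Longrightarrow> adjacent (r i) (r (Suc i))"
    and b: "\<And>i. i < L \<Longrightarrow> adjacent (b i) (b (Suc i))"
    and bot: "\<And>i. i \<le> K \<Longrightarrow> yc (b 0) < yc (r i)"
    and top: "\<And>i. i \<le> K \<Longrightarrow> yc (r i) < yc (b L)"
    and first: "\<And>i. i \<le> L \<Longrightarrow> yc (b i) = yc (r 0) \<Longrightarrow> xd (r 0) \<le> xd (b i)"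
    and last: "\<And>i. i \<le> L \<Longrightarrow> yc (b i) = yc (r K) \<Longrightarrow> xd (b i) \<le> xd (r K)"
  shows "\<exists>m\<le>K. \<exists>n\<le>L. r m = b n"
proof (rule ccontr)
  assume "\<not> ?thesis"
  then have off: "b n \<noteq> r m" if "m \<le> K" "n \<le> L" for m n using that by metis
  define C where "C m = (\<Sum>i<L. crossing b (r m) i)" for m
  have C_Suc: "C m = C (Suc m)" if "m < K" for m
  proof (cases "yc (r m) \<le> yc (r (Suc m))")
    case True
    then show ?thesis
      unfolding C_def using that r b bot top off by (intro sum_crossing_adjacent) auto
  next
    case False
    have "adjacent (r (Suc m)) (r m)"
      using r[OF that] by (auto simp: adjacent_iff)
    then show ?thesis
      unfolding C_def using False that r b bot top off
      by (intro sum_crossing_adjacent[symmetric]) auto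
  qed
  have "m \<le> K \<Longrightarrow> C m = C 0" for m
  proof (induction m)
    case (Suc m)
    then show ?case using C_Suc[of m] by simp
  qed simp
  then have "C K = C 0" by blast
  have "crossing b (r K) i = 0" if "i < L" for i
    using last[of i] last[of "Suc i"] that by (auto simp: crossing_def)
  then have "C K = 0" by (simp add: C_def)
  \<comment> \<open>Every cell of \<open>b\<close> in the row of \<open>r 0\<close> lies to its
    right, so each step between this row and the one above is counted, and the sum telescopes to one
    net ascent.\<close>
  define U :: "nat \<Rightarrow> int" where "U i = of_bool (yc (b i) > yc (r 0))" for i
  have "crossing b (r 0) i = U (Suc i) - U i" if i: "i < L" for i
  proof -
    have right: "xd (b n) > xd (r 0)" if "n \<le> L" "yc (b n) = yc (r 0)" for n
      using first[OF that] off[of 0 n] that cell_eqI[of "b n" "r 0"] by fastforce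
    consider "yc (b (Suc i)) = yc (b i)" | "yc (b (Suc i)) = yc (b i) + 1"
      | "yc (b (Suc i)) = yc (b i) - 1"
      using b[OF i] unfolding adjacent_iff by arith
    then show ?thesis
    proof cases
      case 1
      then show ?thesis by (simp add: crossing_def U_def)
    next
      case 2
      then show ?thesis
        using right[of i] i by (cases "yc (b i) = yc (r 0)") (auto simp: crossing_def U_def)
    next
      case 3
      then show ?thesis
        using right[of "Suc i"] i
        by (cases "yc (b (Suc i)) = yc (r 0)") (auto simp: crossing_def U_def)
    qed
  qed
  then have "C 0 = (\<Sum>i<L. U (Suc i) - U i)" unfolding C_def by (intro sum.cong) auto
  also have "\<dots> = U L - U 0" by (rule sum_lessThan_telescope)
  also have "\<dots> = 1" using bot[of 0] top[of 0] by (simp add: U_def)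
  finally show False using \<open>C K = C 0\<close> \<open>C K = 0\<close> by simp
qed

section \<open>Winning chains in integer coordinates\<close>

definition cell_at :: "int \<Rightarrow> int \<Rightarrow> cell" where
  "cell_at k j = Cell (of_int k + of_int j / 2, j)"

lemma coords_cell_at: "coords (cell_at k j) = (of_int k + of_int j / 2, j)"
  unfolding cell_at_def by (rule Cell_inverse) auto

lemma yc_cell_at [simp]: "yc (cell_at k j) = j"
  by (simp add: coords_cell_at)

lemma xd_cell_at [simp]: "xd (cell_at k j) = 2 * k + j"
proof -
  have "of_int (xd (cell_at k j)) = (of_int (2 * k + j) :: rat)"
    by (simp add: of_int_xd coords_cell_at)
  then show ?thesis by (simp only: of_int_eq_iff)
qed

lemma cell_at_eq_iff [simp]: "cell_at k j = cell_at k' j' \<longleftrightarrow> k = k' \<and> j = j'"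
proof
  assume "cell_at k j = cell_at k' j'"
  then have "xd (cell_at k j) = xd (cell_at k' j')" "yc (cell_at k j) = yc (cell_at k' j')"
    by simp_all
  then show "k = k' \<and> j = j'" by simp
qed simp

lemma xc_less_iff: "xc h < xc h' \<longleftrightarrow> xd h < xd h'"
  using of_int_xd[of h] of_int_xd[of h']
  by (metis mult_less_cancel_left_pos of_int_less_iff zero_less_numeral)

text \<open>The two ends need different test cells: one far up to the right for the forward end, its
  mirror image for the backward end. Conversely, the sum of the absolute coordinates of
  \<open>h\<close> is a bound that serves both ends.\<close>

lemma winning_Red_iff:
  "(\<forall>h. winning_wrt Red r h) \<longleftrightarrow> (\<forall>B. \<exists>M. \<forall>m\<ge>M.
     xd (r m) > B \<and> yc (r m) > B \<and> xd (r (- m)) < - B \<and> yc (r (- m)) < - B)" (is "?L \<longleftrightarrow> ?R")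
proof
  assume L: ?L
  show ?R
  proof
    fix B :: int
    obtain M1 where M1: "\<forall>m\<ge>M1. xd (cell_at \<bar>B\<bar> \<bar>B\<bar>) < xd (r m) \<and> \<bar>B\<bar> < yc (r m)"
      using L[rule_format, of "cell_at \<bar>B\<bar> \<bar>B\<bar>"] by (auto simp: xc_less_iff simp del: xd_cell_at)
    obtain M2 where M2: "\<forall>m\<ge>M2. xd (r (-m)) < xd (cell_at (-\<bar>B\<bar>) (-\<bar>B\<bar>)) \<and> yc (r (-m)) < -\<bar>B\<bar>"
      using L[rule_format, of "cell_at (-\<bar>B\<bar>) (-\<bar>B\<bar>)"] by (auto simp: xc_less_iff simp del: xd_cell_at)
    show "\<exists>M. \<forall>m\<ge>M. xd (r m) > B \<and> yc (r m) > B \<and> xd (r (- m)) < - B \<and> yc (r (- m)) < - B"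
      using M1 M2 by (intro exI[of _ "max M1 M2"]) fastforce
  qed
next
  assume R: ?R
  show ?L
  proof
    fix h
    obtain M where "\<forall>m\<ge>M. xd (r m) > \<bar>xd h\<bar> + \<bar>yc h\<bar> \<and> yc (r m) > \<bar>xd h\<bar> + \<bar>yc h\<bar> \<and>
      xd (r (- m)) < - (\<bar>xd h\<bar> + \<bar>yc h\<bar>) \<and> yc (r (- m)) < - (\<bar>xd h\<bar> + \<bar>yc h\<bar>)"
      using R by metis
    then show "winning_wrt Red r h"
      by (auto simp: xc_less_iff intro!: exI[of _ M])
  qed
qed

lemma winning_BlueD:
  assumes "\<forall>h. winning_wrt Blue b h"
  shows "\<exists>M. \<forall>m\<ge>M. xd (b m) < - B \<and> yc (b m) > B \<and> xd (b (- m)) > B \<and> yc (b (- m)) < - B"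
proof -
  obtain M1 where M1: "\<forall>m\<ge>M1. xd (b m) < xd (cell_at (-\<bar>B\<bar>) \<bar>B\<bar>) \<and> \<bar>B\<bar> < yc (b m)"
    using assms[rule_format, of "cell_at (-\<bar>B\<bar>) \<bar>B\<bar>"]
    by (auto simp: xc_less_iff simp del: xd_cell_at)
  obtain M2 where M2: "\<forall>m\<ge>M2. xd (b (-m)) > xd (cell_at \<bar>B\<bar> (-\<bar>B\<bar>)) \<and> yc (b (-m)) < -\<bar>B\<bar>"
    using assms[rule_format, of "cell_at \<bar>B\<bar> (-\<bar>B\<bar>)"]
    by (auto simp: xc_less_iff simp del: xd_cell_at)
  show ?thesis
    using M1 M2 by (intro exI[of _ "max M1 M2"]) fastforce
qed

lemma bounded_on_interval:
  fixes f :: "int \<Rightarrow> int"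
  obtains B where "B \<ge> 0" "\<And>n. - M \<le> n \<Longrightarrow> n \<le> M \<Longrightarrow> \<bar>f n\<bar> \<le> B"
proof
  show "0 \<le> (\<Sum>n\<in>{-M..M}. \<bar>f n\<bar>)" by (simp add: sum_nonneg)
  show "\<bar>f n\<bar> \<le> (\<Sum>n\<in>{-M..M}. \<bar>f n\<bar>)" if "- M \<le> n" "n \<le> M" for n
    using that by (intro member_le_sum) auto
qed

text \<open>The bounds are chosen alternately. The Red segment ends in rows that the middle part of
  \<open>b\<close> does not reach, so there \<open>b\<close> can occur only in a tail, which lies on
  a known side. The Blue segment is then extended above and below the whole Red segment.\<close>

lemma winning_chains_meet:
  assumes r: "\<And>n. adjacent (r n) (r (n + 1))" "\<forall>h. winning_wrt Red r h"
    and b: "\<And>n. adjacent (b n) (b (n + 1))" "\<forall>h. winning_wrt Blue b h"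
  shows "\<exists>m n. r m = b n"
proof -
  obtain M0 where M0: "\<And>m. m \<ge> M0 \<Longrightarrow>
      xd (b m) < 0 \<and> yc (b m) > 0 \<and> xd (b (- m)) > 0 \<and> yc (b (- m)) < 0"
    using winning_BlueD[OF b(2), of 0] by auto
  obtain B where B: "B \<ge> 0" "\<And>n. - M0 \<le> n \<Longrightarrow> n \<le> M0 \<Longrightarrow> \<bar>yc (b n)\<bar> \<le> B"
    using bounded_on_interval[where f = "\<lambda>n. yc (b n)"] by blast
  obtain M1 where M1: "\<forall>m\<ge>M1. xd (r m) > B \<and> yc (r m) > B \<and> xd (r (- m)) < - B \<and> yc (r (- m)) < - B"
    using r(2) unfolding winning_Red_iff by blast
  define M where "M = max M1 0"
  have M: "M \<ge> 0" "xd (r M) > B" "yc (r M) > B" "xd (r (- M)) < - B" "yc (r (- M)) < - B"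
    using M1 by (auto simp: M_def)
  obtain D where D: "D \<ge> 0" "\<And>n. - M \<le> n \<Longrightarrow> n \<le> M \<Longrightarrow> \<bar>yc (r n)\<bar> \<le> D"
    using bounded_on_interval[where f = "\<lambda>n. yc (r n)"] by blast
  obtain N1 where N1: "\<forall>m\<ge>N1. yc (b m) > D \<and> yc (b (- m)) < - D"
    using winning_BlueD[OF b(2), of D] by blast
  define N where "N = max N1 0"
  have N: "N \<ge> 0" "yc (b N) > D" "yc (b (- N)) < - D"
    using N1 by (auto simp: N_def)
  \<comment> \<open>A cell of \<open>b\<close> this high belongs neither to the middle part, whose
    heights are at most \<open>B\<close>, nor to the tail with negative heights; so it is in the
    tail where \<open>xd\<close> is negative.\<close>
  have upper: "xd (b n) \<le> xd (r M)" if "yc (b n) = yc (r M)" for n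
  proof (cases "n \<ge> M0")
    case True
    then show ?thesis using M0[of n] M B(1) by simp
  next
    case False
    then show ?thesis using M0[of "-n"] B(2)[of n] B(1) M that by (cases "- M0 \<le> n") auto
  qed
  have lower: "xd (r (- M)) \<le> xd (b n)" if "yc (b n) = yc (r (- M))" for n
  proof (cases "- n \<ge> M0")
    case True
    then show ?thesis using M0[of "-n"] M B(1) by simp
  next
    case False
    then show ?thesis using M0[of n] B(2)[of n] B(1) M that by (cases "n \<le> M0") auto
  qed
  have "\<exists>m\<le>nat (2 * M). \<exists>n\<le>nat (2 * N). r (int m - M) = b (int n - N)"
  proof (rule finite_paths_cross)
    show "adjacent (r (int i - M)) (r (int (Suc i) - M))" for i
      using r(1)[of "int i - M"] by (simp add: algebra_simps)
    show "adjacent (b (int i - N)) (b (int (Suc i) - N))" for i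
      using b(1)[of "int i - N"] by (simp add: algebra_simps)
    show "yc (b (int 0 - N)) < yc (r (int i - M))" if "i \<le> nat (2 * M)" for i
      using D(2)[of "int i - M"] N that by (simp add: abs_le_iff le_nat_iff M(1))
    show "yc (r (int i - M)) < yc (b (int (nat (2 * N)) - N))" if "i \<le> nat (2 * M)" for i
      using D(2)[of "int i - M"] N that by (simp add: abs_le_iff le_nat_iff M(1))
  qed (use upper lower M N in auto)
  then show ?thesis by blast
qed

lemma winning_chains_exclusive:
  assumes "contains_winning_chain Red A" "contains_winning_chain Blue B"
  shows "A \<inter> B \<noteq> {}"
  using assms winning_chains_meet unfolding contains_winning_chain_def by (metis disjoint_iff)

lemma has_won_exclusive:
  assumes "has_won P p"
  shows "\<not> has_won (opponent P) p"
proof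
  assume "has_won (opponent P) p"
  then have "cells_of Red p \<inter> cells_of Blue p \<noteq> {}"
    using assms winning_chains_exclusive unfolding has_won_def by (cases P) auto
  then show False by (auto simp: cells_of_def)
qed


section \<open>Locality of winning strategies\<close>

lemma contains_winning_chain_mono:
  "contains_winning_chain P A \<Longrightarrow> A \<subseteq> B \<Longrightarrow> contains_winning_chain P B"
  unfolding contains_winning_chain_def by blast

lemma has_won_mono: "has_won P p \<Longrightarrow> cells_of P p \<subseteq> cells_of P q \<Longrightarrow> has_won P q"
  unfolding has_won_def by (rule contains_winning_chain_mono)

abbreviation move :: "position \<Rightarrow> cell \<Rightarrow> position" where
  "move p h \<equiv> ((fst p)(h := Some (snd p)), opponent (snd p))"

lemma move_in_successors:
  "\<not> has_won P p \<Longrightarrow> \<not> has_won (opponent P) p \<Longrightarrow> fst p h = None \<Longrightarrow> move p h \<in> successors p"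
  unfolding successors_def by (cases P) auto

lemma successorsE:
  assumes "q \<in> successors p"
  obtains h where "fst p h = None" "q = move p h"
  using assms unfolding successors_def by (auto split: if_splits)

lemma opponent_neq [simp]: "opponent P \<noteq> P" "P \<noteq> opponent P"
  by (cases P; simp)+

lemma neq_imp_opponent: "P \<noteq> Q \<Longrightarrow> P = opponent Q"
  by (cases P; cases Q) auto

text \<open>The opponent's stones in \<open>p\<close> may be missing in \<open>q\<close>, and off
  \<open>F\<close> there may be new stones of either player, even infinitely many.\<close>

definition covers :: "player \<Rightarrow> cell set \<Rightarrow> position \<Rightarrow> position \<Rightarrow> bool" where
  "covers P F p q \<longleftrightarrow> snd q = snd p \<and> cells_of P p \<subseteq> cells_of P q \<and>
     (\<forall>h\<in>F. fst p h = None \<longrightarrow> fst q h = None)"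

text \<open>
  Opponent's stones other than those in \<open>F\<close> are irrelevant, even if they complete a chain of the
  opponent: \<open>P\<close> would still complete a chain in \<open>F\<close>, and there cannot be two disjoint
  winning chains. If the opponent is to move, fix any move of his. The region \<open>F\<^sub>0\<close> of the
  resulting position also serves as an answer to all moves that do not hit \<open>F\<^sub>0\<close>, and
  only finitely many do.
\<close>

lemma value_local:
  assumes "value_le P p \<alpha>"
  shows "\<exists>F n. finite F \<and>
    (\<forall>q. covers P F p q \<longrightarrow> value_le P q (fin_ord n) \<and> \<not> has_won (opponent P) q)"
  using assms
proof (induction rule: value_le.induct)
  case (won p \<alpha>)
  have "value_le P q (fin_ord 0) \<and> \<not> has_won (opponent P) q" if "covers P {} p q" for q
  proof -
    have "has_won P q" using won has_won_mono that by (auto simp: covers_def)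
    then show ?thesis by (auto intro: value_le.won dest: has_won_exclusive)
  qed
  then show ?case by blast
next
  case (own p p' \<beta> \<alpha>)
  obtain h where h: "fst p h = None" "p' = move p h"
    using own.hyps(3) by (rule successorsE)
  obtain F n where F: "finite F"
    and IH: "\<And>q. covers P F p' q \<Longrightarrow> value_le P q (fin_ord n) \<and> \<not> has_won (opponent P) q"
    using own.IH by blast
  have "value_le P q (fin_ord (Suc n)) \<and> \<not> has_won (opponent P) q"
    if q: "covers P (insert h F) p q" for q
  proof (cases "has_won P q")
    case True
    then show ?thesis by (auto intro: value_le.won dest: has_won_exclusive)
  next
    case False
    have qh: "fst q h = None" using q h by (auto simp: covers_def)
    have "covers P F p' (move q h)"
      using q h by (auto simp: covers_def cells_of_def)
    from IH[OF this] have v: "value_le P (move q h) (fin_ord n)"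
      and nw: "\<not> has_won (opponent P) (move q h)" by auto
    have sq: "snd q = P" using q own.hyps(2) by (simp add: covers_def)
    \<comment> \<open>A chain of the opponent in \<open>q\<close> would survive the move at
      \<open>h\<close>, so its absence is inherited from the position after the move.\<close>
    have "\<not> has_won (opponent P) q"
      using nw by (rule contrapos_nn) (erule has_won_mono, use qh in \<open>auto simp: cells_of_def\<close>)
    moreover from this have "value_le P q (fin_ord (Suc n))"
      using value_le.own[OF False sq _ v] move_in_successors[OF False _ qh] by (simp add: less_ord_succ)
    ultimately show ?thesis by blast
  qed
  then show ?case using F by (intro exI[of _ "insert h F"] exI[of _ "Suc n"]) auto
next
  case (opp p \<alpha>)
  have sp: "snd p = opponent P" using opp.hyps(2) by (rule neq_imp_opponent)
  have nw: "\<not> has_won (opponent P) p"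
    using opp.hyps(3) by (cases P) (auto simp: successors_def split: if_splits)
  obtain h\<^sub>0 where h\<^sub>0: "fst p h\<^sub>0 = None"
    using opp.hyps(3) by (auto elim: successorsE)
  have "\<exists>F n. fst p h = None \<longrightarrow> finite F \<and>
      (\<forall>q. covers P F (move p h) q \<longrightarrow> value_le P q (fin_ord n) \<and> \<not> has_won (opponent P) q)" for h
  proof (cases "fst p h = None")
    case True
    show ?thesis using opp.IH[OF move_in_successors[OF opp.hyps(1) nw True]] by simp
  next
    case False
    then show ?thesis by (intro exI impI) (erule notE)
  qed
  then obtain F n where F: "\<And>h. fst p h = None \<Longrightarrow> finite (F h)"
    and IH: "\<And>h q. fst p h = None \<Longrightarrow> covers P (F h) (move p h) q \<Longrightarrow>
      value_le P q (fin_ord (n h)) \<and> \<not> has_won (opponent P) q"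
    by metis
  \<comment> \<open>Including \<open>h\<^sub>0\<close> keeps that cell empty in \<open>q\<close>, so
    that the opponent can move there, and makes the set under \<open>Max\<close> nonempty.\<close>
  define H where "H = {h \<in> insert h\<^sub>0 (F h\<^sub>0). fst p h = None}"
  have fH: "finite H" "h\<^sub>0 \<in> H" using F[OF h\<^sub>0] h\<^sub>0 by (auto simp: H_def)
  define G where "G = H \<union> (\<Union>h\<in>H. F h)"
  define N where "N = Max (n ` H)"
  have fG: "finite G" using fH F by (auto simp: G_def H_def)
  have nN: "n h \<le> N" if "h \<in> H" for h using fH that by (simp add: N_def)
  have "value_le P q (fin_ord N) \<and> \<not> has_won (opponent P) q" if q: "covers P G p q" for q
  proof (cases "has_won P q")
    case True
    then show ?thesis by (auto intro: value_le.won dest: has_won_exclusive)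
  next
    case False
    have sq: "snd q = opponent P" using q sp by (simp add: covers_def)
    have qh\<^sub>0: "fst q h\<^sub>0 = None" using q h\<^sub>0 fH by (auto simp: covers_def G_def)
    have *: "value_le P (move q h) (fin_ord N) \<and> \<not> has_won (opponent P) (move q h)"
      if h: "fst q h = None" for h
    proof -
      have "\<exists>g\<in>H. covers P (F g) (move p g) (move q h)"
      proof (cases "h \<in> H")
        case True
        then have "covers P (F h) (move p h) (move q h)"
          using q h by (auto simp: covers_def cells_of_def G_def)
        then show ?thesis using True by blast
      next
        case False
        \<comment> \<open>The cell \<open>h\<^sub>0\<close> stays empty here but is the opponent's
          in \<open>move p h\<^sub>0\<close>; \<open>covers\<close> allows this.\<close>
        then have "covers P (F h\<^sub>0) (move p h\<^sub>0) (move q h)"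
          using q h sp fH(2) by (auto simp: covers_def cells_of_def G_def H_def)
        then show ?thesis using fH by blast
      qed
      then obtain g where g: "g \<in> H" "covers P (F g) (move p g) (move q h)" by blast
      have "fst p g = None" using g(1) by (simp add: H_def)
      from IH[OF this g(2)]
      have "value_le P (move q h) (fin_ord (n g)) \<and> \<not> has_won (opponent P) (move q h)" .
      moreover have "fin_ord (n g) \<le> fin_ord N"
        using nN[OF g(1)] strict_mono_fin_ord by (simp add: strict_mono_less_eq)
      ultimately show ?thesis using value_le_mono by blast
    qed
    have nwq: "\<not> has_won (opponent P) q"
      using *[OF qh\<^sub>0] by (auto elim!: contrapos_nn has_won_mono simp: cells_of_def sq)
    have "successors q \<noteq> {}" using move_in_successors[OF False nwq qh\<^sub>0] by blast
    moreover have "value_le P q' (fin_ord N)" if "q' \<in> successors q" for q'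
      using that * by (metis successorsE)
    ultimately have "value_le P q (fin_ord N)"
      using False sq by (simp add: value_le.opp)
    then show ?thesis using nwq by blast
  qed
  then show ?case using fG by blast
qed

lemma game_value_le_iff: "value_le P p \<alpha> \<longleftrightarrow> (\<exists>\<beta>\<le>\<alpha>. game_value P p = Some \<beta>)"
  using valuation_unique[OF is_valuation_game_value] value_le_mono by blast

lemma game_value_finite:
  assumes "game_value P p = Some \<alpha>"
  shows "\<alpha> < ord_omega"
proof -
  have "value_le P p \<alpha>" using assms by (auto simp: game_value_le_iff)
  \<comment> \<open>Every position covers itself, for any region.\<close>
  from value_local[OF this] obtain n where "value_le P p (fin_ord n)"
    unfolding covers_def by blast
  then have "\<alpha> \<le> fin_ord n" using assms by (auto simp: game_value_le_iff)
  also have "\<dots> < ord_omega" by (auto simp: less_ord_omega_iff)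
  finally show ?thesis .
qed


section \<open>Games with finitely many empty cells\<close>

lemma cells_of_successor:
  "q \<in> successors p \<Longrightarrow> cells_of P p \<subseteq> cells_of P q"
  by (auto elim!: successorsE simp: cells_of_def)

text \<open>A play makes finitely many moves and then repeats its last position. A win in the limit
  is thus a win in that position, and the won plays are the union of the basic open sets given by
  the final positions won by \<open>P\<close>.\<close>

lemma open_for_if_finite_empty:
  assumes "finite {h. fst g h = None}"
  shows "open_for P g"
proof -
  have final: "\<exists>N. successors (\<pi> N) = {}" if \<pi>: "\<pi> \<in> plays g" for \<pi>
  proof (rule ccontr)
    assume "\<nexists>N. successors (\<pi> N) = {}"
    then have s: "\<pi> (Suc n) \<in> successors (\<pi> n)" for n
      using \<pi> by (auto simp: plays_def)
    let ?E = "\<lambda>n. {h. fst (\<pi> n) h = None}"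
    have sub: "?E (Suc n) \<subset> ?E n" for n
    proof -
      obtain h where h: "fst (\<pi> n) h = None" "\<pi> (Suc n) = move (\<pi> n) h"
        using s[of n] by (rule successorsE)
      then have "?E (Suc n) = ?E n - {h}" by auto
      then show ?thesis using h(1) by auto
    qed
    have fin: "finite (?E n)" for n
    proof (induction n)
      case 0
      then show ?case using assms \<pi> by (simp add: plays_def)
    next
      case (Suc n)
      then show ?case using sub[of n] finite_subset by blast
    qed
    have dec: "card (?E (Suc n)) < card (?E n)" for n
      using fin sub by (rule psubset_card_mono)
    have "card (?E n) + n \<le> card (?E 0)" for n
    proof (induction n)
      case (Suc n)
      then show ?case using dec[of n] by linarith
    qed simp
    from this[of "Suc (card (?E 0))"] show False by simp
  qed
  have inc: "cells_of P (\<pi> n) \<subseteq> cells_of P (\<pi> m)" if "\<pi> \<in> plays g" "n \<le> m" for \<pi> n m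
    using that(2)
  proof (induction m rule: dec_induct)
    case (step m)
    have "\<pi> (Suc m) \<in> successors (\<pi> m) \<or> \<pi> (Suc m) = \<pi> m"
      using that(1) by (auto simp: plays_def)
    then have "cells_of P (\<pi> m) \<subseteq> cells_of P (\<pi> (Suc m))"
      using cells_of_successor by (metis order_refl)
    then show ?case using step.IH by (rule order_trans[rotated])
  qed simp
  have stop: "(\<Union>n. cells_of P (\<pi> n)) = cells_of P (\<pi> N)"
    if \<pi>: "\<pi> \<in> plays g" and N: "successors (\<pi> N) = {}" for \<pi> N
  proof -
    have const: "\<pi> m = \<pi> N" if "m \<ge> N" for m
      using that
    proof (induction m rule: dec_induct)
      case (step m)
      have "\<pi> (Suc m) \<in> successors (\<pi> m) \<or> \<pi> (Suc m) = \<pi> m"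
        using \<pi> by (auto simp: plays_def)
      then show ?case using step.IH N by simp
    qed simp
    have "cells_of P (\<pi> n) \<subseteq> cells_of P (\<pi> N)" for n
      using inc[OF \<pi>, of n N] const[of n] by (cases "n \<le> N") auto
    then show ?thesis by blast
  qed
  define V where "V = {v. successors v = {} \<and> has_won P v}"
  have "won_plays P g = \<Union> (plays_through g ` V)"
  proof (intro equalityI subsetI)
    fix \<pi> assume w: "\<pi> \<in> won_plays P g"
    then have \<pi>: "\<pi> \<in> plays g" by (simp add: won_plays_def)
    obtain N where N: "successors (\<pi> N) = {}" using final[OF \<pi>] by blast
    then have "\<pi> N \<in> V" using w stop[OF \<pi> N] by (simp add: V_def won_plays_def has_won_def)
    then show "\<pi> \<in> \<Union> (plays_through g ` V)" using \<pi> by (auto simp: plays_through_def)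
  next
    fix \<pi> assume "\<pi> \<in> \<Union> (plays_through g ` V)"
    then obtain N where \<pi>: "\<pi> \<in> plays g" "\<pi> N \<in> V"
      unfolding plays_through_def by blast
    then show "\<pi> \<in> won_plays P g" using stop[OF \<pi>(1), of N]
      by (simp add: V_def won_plays_def has_won_def)
  qed
  then show ?thesis
    unfolding open_for_def play_topology_def
    by (simp only:) (rule openin_Union, blast intro: topology_generated_by_Basis)
qed


section \<open>A row of bridges\<close>

text \<open>
  The Red cells \<open>(t, t)\<close> and \<open>(t + 1, t + 1)\<close>, in the coordinates of \<open>cell_at\<close>, have exactly two
  common neighbours. Either of them connects the two, so Red can answer an intrusion into one
  by occupying the other one.
\<close>

definition side :: "bool \<Rightarrow> int \<Rightarrow> cell" where
  "side s t = (if s then cell_at (t + 1) t else cell_at t (t + 1))"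

lemma side_eq_iff [simp]: "side s t = side s' t' \<longleftrightarrow> s = s' \<and> t = t'"
  by (auto simp: side_def)

lemma side_neq_diagonal [simp]: "side s t \<noteq> cell_at u u" "cell_at u u \<noteq> side s t"
  by (auto simp: side_def)

text \<open>The chain alternates between diagonal cells and chosen sides; its \<open>n\<close>-th
  cell is the one whose \<open>cell_at\<close> coordinates have sum \<open>n\<close>.\<close>

lemma bridges_connect:
  assumes "\<And>t. cell_at t t \<in> A" "\<And>t. \<exists>s. side s t \<in> A"
  shows "contains_winning_chain Red A"
proof -
  obtain s where s: "\<And>t. side (s t) t \<in> A" using assms(2) by metis
  define r where "r n = (if even n then cell_at (n div 2) (n div 2) else side (s (n div 2)) (n div 2))"
    for n :: int
  have xy: "yc (r n) \<ge> n div 2" "yc (r n) \<le> n div 2 + 1"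
    "xd (r n) \<ge> 3 * (n div 2)" "xd (r n) \<le> 3 * (n div 2) + 2" for n
    by (auto simp: r_def side_def)
  have "adjacent (r n) (r (n + 1))" for n
  proof (cases "even n")
    case True
    then have "(n + 1) div 2 = n div 2" by presburger
    then show ?thesis using True by (auto simp: r_def side_def adjacent_iff)
  next
    case False
    then have "(n + 1) div 2 = n div 2 + 1" by presburger
    then show ?thesis using False by (auto simp: r_def side_def adjacent_iff)
  qed
  moreover have "r n \<in> A" for n using assms(1) s by (simp add: r_def)
  moreover have "\<forall>h. winning_wrt Red r h"
    unfolding winning_Red_iff
  proof
    fix B :: int
    \<comment> \<open>The generous slack of 10 absorbs the rounding in \<open>div 2\<close> and the
      offsets in \<open>xy\<close>.\<close>
    have "xd (r m) > B \<and> yc (r m) > B \<and> xd (r (- m)) < - B \<and> yc (r (- m)) < - B"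
      if "m \<ge> 2 * \<bar>B\<bar> + 10" for m
    proof -
      have "m div 2 \<ge> \<bar>B\<bar> + 5" "(- m) div 2 \<le> - \<bar>B\<bar> - 5" using that by linarith+
      then show ?thesis using xy[of m] xy[of "-m"] by linarith
    qed
    then show "\<exists>M. \<forall>m\<ge>M. xd (r m) > B \<and> yc (r m) > B \<and> xd (r (- m)) < - B \<and> yc (r (- m)) < - B"
      by blast
  qed
  ultimately show ?thesis unfolding contains_winning_chain_def by blast
qed

text \<open>Staying below \<open>v\<close> is invariant because no ascent can jump over
  \<open>v\<close>; descents may be of any size.\<close>

lemma int_chain_hits:
  fixes f :: "int \<Rightarrow> int"
  assumes "\<And>n. f (n + 1) \<le> f n + 1" "a \<le> b" "f a \<le> v" "v \<le> f b"
  shows "\<exists>n. f n = v"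
proof (rule ccontr)
  assume "\<nexists>n. f n = v"
  then have neq: "f n \<noteq> v" for n by blast
  have "f n < v" if "a \<le> n" for n
    using that
  proof (induction n rule: int_ge_induct)
    case base
    then show ?case using assms(3) neq[of a] by simp
  next
    case (step n)
    then show ?case using assms(1)[of n] neq[of "n + 1"] by linarith
  qed
  then show False using assms(2,4) by (meson not_less)
qed

definition band :: "cell set" where
  "band = range (\<lambda>t. cell_at t t) \<union> range (\<lambda>(s, t). side s t)"

text \<open>A step to a neighbour raises the sum of the \<open>cell_at\<close> coordinates by at
  most 1, so a winning chain attains every sum. Within \<open>band\<close> the sum
  \<open>2 * t + 1\<close> occurs only at the two sides with index \<open>t\<close>.\<close>

lemma bridges_needed:
  assumes "contains_winning_chain Red A" "A \<subseteq> band"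
  shows "\<exists>s. side s t \<in> A"
proof -
  obtain r where r: "\<And>n. r n \<in> A" "\<And>n. adjacent (r n) (r (n + 1))" "\<forall>h. winning_wrt Red r h"
    using assms(1) unfolding contains_winning_chain_def by blast
  \<comment> \<open>For \<open>cell_at k j\<close> this is \<open>k + j\<close>; the division is
    exact by parity.\<close>
  define f where "f n = (xd (r n) + yc (r n)) div 2" for n
  have f: "2 * f n = xd (r n) + yc (r n)" for n
    using even_xd_diff[of "r n"] unfolding f_def by presburger
  obtain M where "\<forall>m\<ge>M. xd (r m) > 2 * \<bar>t\<bar> + 1 \<and> yc (r m) > 2 * \<bar>t\<bar> + 1 \<and>
      xd (r (- m)) < - (2 * \<bar>t\<bar> + 1) \<and> yc (r (- m)) < - (2 * \<bar>t\<bar> + 1)"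
    using r(3) unfolding winning_Red_iff by blast
  then have M: "xd (r \<bar>M\<bar>) > 2 * \<bar>t\<bar> + 1" "yc (r \<bar>M\<bar>) > 2 * \<bar>t\<bar> + 1"
      "xd (r (- \<bar>M\<bar>)) < - (2 * \<bar>t\<bar> + 1)" "yc (r (- \<bar>M\<bar>)) < - (2 * \<bar>t\<bar> + 1)"
    by (meson abs_ge_self)+
  have "\<exists>n. f n = 2 * t + 1"
  proof (rule int_chain_hits)
    show "f (n + 1) \<le> f n + 1" for n
      using r(2)[of n] f[of n] f[of "n + 1"] by (auto simp: adjacent_iff)
    show "- \<bar>M\<bar> \<le> \<bar>M\<bar>" by simp
    show "f (- \<bar>M\<bar>) \<le> 2 * t + 1" "2 * t + 1 \<le> f \<bar>M\<bar>"
      using M f[of "\<bar>M\<bar>"] f[of "- \<bar>M\<bar>"] by linarith+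
  qed
  then obtain n where n: "f n = 2 * t + 1" by blast
  have "r n \<in> band" using r(1) assms(2) by blast
  then obtain u where "r n = cell_at u u \<or> (\<exists>s. r n = side s u)" by (auto simp: band_def)
  then obtain s where "r n = side s t"
    using f[of n] n by (auto simp: side_def split: if_splits)
  then show ?thesis using r(1)[of n] by metis
qed

section \<open>Counting stones and the values of bridge games\<close>

text \<open>Along one line of play with arbitrary moves of the opponent, \<open>T\<close> collects
  the stones of \<open>P\<close>, each of which lowers the bound on the value. Hence a position that
  lacks many stones cannot have a small value.\<close>

lemma value_le_stones:
  assumes "value_le P p \<alpha>" "\<alpha> = fin_ord n"
  shows "\<exists>T. finite T \<and> card T \<le> n \<and> T \<subseteq> {h. fst p h = None} \<and>
    contains_winning_chain P (cells_of P p \<union> T)"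
  using assms
proof (induction arbitrary: n rule: value_le.induct)
  case (won p \<alpha>)
  then show ?case by (intro exI[of _ "{}"]) (simp add: has_won_def)
next
  case (own p q \<beta> \<alpha>)
  obtain m where m: "m < n" "\<beta> = fin_ord m"
    using own by (auto simp: less_fin_ord_iff)
  obtain h where h: "fst p h = None" "q = move p h" using own.hyps(3) by (rule successorsE)
  obtain T where T: "finite T" "card T \<le> m" "T \<subseteq> {h. fst q h = None}"
    "contains_winning_chain P (cells_of P q \<union> T)"
    using own.IH m(2) by blast
  have "cells_of P q \<union> T = cells_of P p \<union> insert h T"
    using h own.hyps(2) by (auto simp: cells_of_def)
  then show ?case
    using T m h by (intro exI[of _ "insert h T"]) (auto simp: card_insert_if split: if_splits)
next
  case (opp p \<alpha>)
  obtain q where q: "q \<in> successors p" using opp.hyps(3) by blast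
  obtain h where h: "fst p h = None" "q = move p h" using q by (rule successorsE)
  obtain T where T: "finite T" "card T \<le> n" "T \<subseteq> {h. fst q h = None}"
    "contains_winning_chain P (cells_of P q \<union> T)"
    using opp.IH q opp.prems by blast
  have "cells_of P q = cells_of P p" using h opp.hyps(2) by (auto simp: cells_of_def)
  then show ?case using T h by (intro exI[of _ T]) (auto split: if_splits)
qed

text \<open>The invariant after each answer of Red, with \<open>D\<close> the set of bridges still
  open.\<close>

definition bridge_position :: "int set \<Rightarrow> position \<Rightarrow> bool" where
  "bridge_position D p \<longleftrightarrow> snd p = Blue \<and> (\<forall>t. fst p (cell_at t t) = Some Red) \<and>
     (\<forall>h. fst p h = None \<longleftrightarrow> (\<exists>t\<in>D. \<exists>s. h = side s t)) \<and>
     (\<forall>t. t \<notin> D \<longrightarrow> (\<exists>s. fst p (side s t) = Some Red))"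

text \<open>If the empty cells are imagined Red, the cells that are not Blue contain a Red chain,
  which leaves none for Blue.\<close>

lemma bridge_position_not_won_Blue:
  assumes "bridge_position D p"
  shows "\<not> has_won Blue p"
proof
  assume b: "has_won Blue p"
  define A where "A = {h. fst p h \<noteq> Some Blue}"
  have "contains_winning_chain Red A"
  proof (rule bridges_connect)
    show "cell_at t t \<in> A" for t using assms by (simp add: A_def bridge_position_def)
    show "\<exists>s. side s t \<in> A" for t
    proof (cases "t \<in> D")
      case True
      then have "fst p (side True t) = None" using assms unfolding bridge_position_def by blast
      then have "side True t \<in> A" by (simp add: A_def)
      then show ?thesis by blast
    next
      case False
      then obtain s where "fst p (side s t) = Some Red"
        using assms unfolding bridge_position_def by blast
      then have "side s t \<in> A" by (simp add: A_def)
      then show ?thesis by blast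
    qed
  qed
  then have "A \<inter> cells_of Blue p \<noteq> {}"
    using b winning_chains_exclusive unfolding has_won_def by blast
  then show False by (auto simp: A_def cells_of_def)
qed

text \<open>Each exchange closes one bridge and restores the invariant. Only Red's answer costs a
  successor, so the bound drops by one per bridge.\<close>

lemma bridge_position_value:
  assumes "finite D" "bridge_position D p"
  shows "value_le Red p (fin_ord (card D))"
  using assms
proof (induction "card D" arbitrary: D p)
  case 0
  then have "contains_winning_chain Red (cells_of Red p)"
    by (intro bridges_connect) (auto simp: bridge_position_def cells_of_def)
  then show ?case by (simp add: has_won_def value_le.won)
next
  case (Suc n)
  show ?case
  proof (cases "has_won Red p")
    case False
    have sp: "snd p = Blue" using Suc.prems by (simp add: bridge_position_def)
    have nwB: "\<not> has_won Blue p" using Suc.prems bridge_position_not_won_Blue by blast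
    have "value_le Red q (fin_ord (card D))" if q: "q \<in> successors p" for q
    proof -
      obtain h where h: "fst p h = None" "q = move p h" using q by (rule successorsE)
      then obtain s t where t: "t \<in> D" "h = side s t"
        using Suc.prems unfolding bridge_position_def by blast
      define q' where "q' = move q (side (\<not> s) t)"
      have e: "fst p (side (\<not> s) t) = None"
        using t Suc.prems unfolding bridge_position_def by blast
      have bp: "bridge_position (D - {t}) q'"
        unfolding bridge_position_def
      proof (intro conjI allI impI)
        show "snd q' = Blue" using h sp by (simp add: q'_def)
        show "fst q' (cell_at u u) = Some Red" for u
          using h t Suc.prems by (simp add: q'_def bridge_position_def)
        show "fst q' g = None \<longleftrightarrow> (\<exists>u\<in>D - {t}. \<exists>s. g = side s u)" for g
        proof -
          have "fst q' g = None \<longleftrightarrow> fst p g = None \<and> g \<noteq> side s t \<and> g \<noteq> side (\<not> s) t"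
            using h t by (auto simp: q'_def)
          also have "fst p g = None \<longleftrightarrow> (\<exists>u\<in>D. \<exists>s. g = side s u)"
            using Suc.prems unfolding bridge_position_def by simp
          finally show ?thesis by (cases s) auto
        qed
        show "\<exists>s. fst q' (side s u) = Some Red" if u: "u \<notin> D - {t}" for u
        proof (cases "u = t")
          case True
          then show ?thesis using h sp by (intro exI[of _ "\<not> s"]) (simp add: q'_def)
        next
          case False
          then obtain s' where "fst p (side s' u) = Some Red"
            using u Suc.prems unfolding bridge_position_def by blast
          then show ?thesis using h t False by (intro exI[of _ s']) (simp add: q'_def)
        qed
      qed
      have card: "card (D - {t}) = n" "card D = Suc n" using Suc.hyps(2) Suc.prems(1) t by simp_all
      have v: "value_le Red q' (fin_ord n)"
        using Suc.hyps(1)[of "D - {t}" q'] Suc.prems(1) card bp by simp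
      show ?thesis
      proof (cases "has_won Red q")
        case won: False
        \<comment> \<open>Red's answer adds no Blue stone, so the absence of a Blue win in
          \<open>q'\<close> carries back to \<open>q\<close>, where the invariant fails.\<close>
        have "cells_of Blue q \<subseteq> cells_of Blue q'"
          using e h t by (auto simp: q'_def cells_of_def)
        then have "\<not> has_won Blue q"
          using bridge_position_not_won_Blue[OF bp] has_won_mono by blast
        then have "q' \<in> successors q"
          unfolding q'_def using won e h t by (intro move_in_successors[of Red]) auto
        then show ?thesis
          using value_le.own[OF won _ _ v] h sp card by (simp add: less_ord_succ)
      qed (rule value_le.won)
    qed
    moreover have "successors p \<noteq> {}"
    proof -
      obtain t where "t \<in> D" using Suc.hyps(2) by fastforce
      then have "fst p (side True t) = None" using Suc.prems unfolding bridge_position_def by blast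
      then have "move p (side True t) \<in> successors p"
        using False nwB by (intro move_in_successors[of Red]) simp_all
      then show ?thesis by blast
    qed
    ultimately show ?thesis using False sp by (simp add: value_le.opp)
  qed (rule value_le.won)
qed

text \<open>Blue stones off \<open>band\<close> bar any detour around a bridge, and only finitely
  many cells are left empty, which makes the game open.\<close>

definition bridge_game :: "nat \<Rightarrow> position" where
  "bridge_game n = (\<lambda>h. if \<exists>t\<in>{0..<int n}. \<exists>s. h = side s t then None
     else if h \<in> band then Some Red else Some Blue, Blue)"

lemma bridge_position_bridge_game: "bridge_position {0..<int n} (bridge_game n)"
  unfolding bridge_position_def bridge_game_def band_def by auto

lemma open_for_bridge_game: "open_for P (bridge_game n)"
proof (rule open_for_if_finite_empty)
  have "{h. fst (bridge_game n) h = None} \<subseteq> (\<lambda>(s, t). side s t) ` (UNIV \<times> {0..<int n})"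
    by (auto simp: bridge_game_def split: if_splits)
  then show "finite {h. fst (bridge_game n) h = None}"
    by (rule finite_subset) auto
qed

text \<open>Any completing set of stones contains a cell of each open bridge, and different bridges
  share no cell.\<close>

lemma bridge_game_value:
  assumes "value_le Red (bridge_game n) (fin_ord m)"
  shows "n \<le> m"
proof -
  let ?p = "bridge_game n"
  obtain T where T: "finite T" "card T \<le> m" "T \<subseteq> {h. fst ?p h = None}"
    "contains_winning_chain Red (cells_of Red ?p \<union> T)"
    using value_le_stones[OF assms refl] by blast
  have "cells_of Red ?p \<subseteq> band"
    by (auto simp: cells_of_def bridge_game_def split: if_splits)
  moreover have "{h. fst ?p h = None} \<subseteq> band"
    by (auto simp: bridge_game_def band_def split: if_splits)
  ultimately have "cells_of Red ?p \<union> T \<subseteq> band" using T(3) by blast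
  then have "\<exists>s. side s t \<in> cells_of Red ?p \<union> T" for t
    using bridges_needed T(4) by blast
  moreover have "side s t \<notin> cells_of Red ?p" if "t \<in> {0..<int n}" for s t
    using that by (auto simp: cells_of_def bridge_game_def)
  ultimately obtain s where s: "\<And>t. t \<in> {0..<int n} \<Longrightarrow> side (s t) t \<in> T"
    by (metis UnE)
  have "card {0..<int n} \<le> card T"
    by (rule card_inj_on_le[of "\<lambda>t. side (s t) t"]) (use s T in \<open>auto simp: inj_on_def\<close>)
  then show ?thesis using T(2) by simp
qed

theorem theorem2p45:
  shows "hex_omega_one = ord_omega"
  unfolding hex_omega_one_def ord_sup_def
proof (rule Least_equality)
  show "\<forall>\<alpha>\<in>{\<alpha>. \<exists>P g. open_for P g \<and> game_value P g = Some \<alpha>}. \<alpha> \<le> ord_omega"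
    using game_value_finite less_imp_le by blast
next
  fix \<beta> assume ub: "\<forall>\<alpha>\<in>{\<alpha>. \<exists>P g. open_for P g \<and> game_value P g = Some \<alpha>}. \<alpha> \<le> \<beta>"
  show "ord_omega \<le> \<beta>"
  proof (rule ccontr)
    assume "\<not> ord_omega \<le> \<beta>"
    then obtain n where n: "\<beta> = fin_ord n" by (auto simp: not_le less_ord_omega_iff)
    \<comment> \<open>One bridge more than the supposed bound \<open>fin_ord n\<close>
      allows.\<close>
    have "value_le Red (bridge_game (Suc n)) (fin_ord (Suc n))"
      using bridge_position_value[OF _ bridge_position_bridge_game, of "Suc n"]
      by (simp del: fin_ord_Suc of_nat_Suc)
    then obtain \<alpha> where \<alpha>: "game_value Red (bridge_game (Suc n)) = Some \<alpha>"
      by (auto simp: game_value_le_iff)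
    then have "\<alpha> \<le> fin_ord n" using ub open_for_bridge_game n by blast
    then have "value_le Red (bridge_game (Suc n)) (fin_ord n)"
      using \<alpha> by (auto simp: game_value_le_iff)
    then show False using bridge_game_value by fastforce
  qed
qed

end
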